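(* Let $D$ be a domain in $\mathbb{C}$ and let $C>0$. Then the family $\mathcal{F}$ of all functions $f$ meromorphic in $D$ such that $$\frac{|f''(z)|}{1+|f(z)|^{3}} > C \quad\text{for every } z\in D$$ is normal in $D$.
   Context: A domain is a nonempty connected open subset of $\mathbb{C}$. At a pole $z_0$ of $f$, the value of the quotient $\frac{|f''(z)|}{1+|f(z)|^{3}}$ is understood as its limit as $z\to z_0$. A family $\mathcal{F}$ of functions meromorphic in $D$ is normal in $D$ if every sequence of functions in $\mathcal{F}$ has a subsequence that converges, uniformly on compact subsets of $D$ with respect to the spherical metric on $\widehat{\mathbb{C}}=\mathbb{C}\cup\{\infty\}$, to a limit function which is either meromorphic in $D$ or identically $\infty$. *)

theory Defs
  imports "HOL-Complex_Analysis.Complex_Analysis"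
begin

definition is_domain :: "complex set \<Rightarrow> bool" where
  "is_domain D \<longleftrightarrow> D \<noteq> {} \<and> open D \<and> connected D"

datatype sphere = Fin complex | Infty

(* Angle between two points of the unit sphere under stereographic projection, that is,
   2 * arcsin (c / 2) where c is the chordal distance
     c = 2 * |z - w| / (sqrt (1 + |z|^2) * sqrt (1 + |w|^2)). *)
fun spherical_dist :: "sphere \<Rightarrow> sphere \<Rightarrow> real" where
  "spherical_dist (Fin z) (Fin w) =
     2 * arcsin (cmod (z - w) / (sqrt (1 + (cmod z)\<^sup>2) * sqrt (1 + (cmod w)\<^sup>2)))"
| "spherical_dist (Fin z) Infty = 2 * arcsin (1 / sqrt (1 + (cmod z)\<^sup>2))"
| "spherical_dist Infty (Fin w) = 2 * arcsin (1 / sqrt (1 + (cmod w)\<^sup>2))"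
| "spherical_dist Infty Infty = 0"

(* A meromorphic function on D is represented by f with f nicely_meromorphic_on D: removable
   singularities are filled in and the junk value 0 is stored at poles. This is the induced map
   into the sphere. *)
definition sphere_val :: "(complex \<Rightarrow> complex) \<Rightarrow> complex \<Rightarrow> sphere" where
  "sphere_val f z = (if is_pole f z then Infty else Fin (f z))"

definition spherically_locally_uniform_limit ::
    "complex set \<Rightarrow> (nat \<Rightarrow> complex \<Rightarrow> sphere) \<Rightarrow> (complex \<Rightarrow> sphere) \<Rightarrow> bool" where
  "spherically_locally_uniform_limit D s g \<longleftrightarrow>
     (\<forall>K. compact K \<and> K \<subseteq> D \<longrightarrow>
        uniform_limit K (\<lambda>n z. spherical_dist (s n z) (g z)) (\<lambda>z. 0) sequentially)"

definition normal_family :: "complex set \<Rightarrow> (complex \<Rightarrow> complex) set \<Rightarrow> bool" where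
  "normal_family D \<F> \<longleftrightarrow>
     (\<forall>s :: nat \<Rightarrow> complex \<Rightarrow> complex. (\<forall>n. s n \<in> \<F>) \<longrightarrow>
        (\<exists>r :: nat \<Rightarrow> nat. strict_mono r \<and>
          ((\<exists>g. g nicely_meromorphic_on D \<and>
              spherically_locally_uniform_limit D (\<lambda>n. sphere_val (s (r n))) (sphere_val g)) \<or>
           spherically_locally_uniform_limit D (\<lambda>n. sphere_val (s (r n))) (\<lambda>z. Infty))))"

(* For f meromorphic at a pole z, the limit exists: it is 2 / |a|^2 at a simple pole with
   residue a, and 0 at a multiple pole. *)
definition deriv2_quotient :: "(complex \<Rightarrow> complex) \<Rightarrow> complex \<Rightarrow> real" where
  "deriv2_quotient f z =
     (if is_pole f z
      then Lim (at z) (\<lambda>w. cmod (deriv (deriv f) w) / (1 + cmod (f w) ^ 3))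
      else cmod (deriv (deriv f) z) / (1 + cmod (f z) ^ 3))"

end

theory Submission
  imports Defs
begin

text \<open>
  Let \<open>f\<close> satisfy the inequality. At every point that is not a pole, \<open>\<bar>f''\<bar>\<close> exceeds
  \<open>C \<bar>f\<bar>\<^sup>j\<close> for each \<open>j \<le> 3\<close>, so the four quotients \<open>U\<^sub>j = f\<^sup>j / f''\<close> are bounded by \<open>1 / C\<close>
  and extend holomorphically over the poles. Boundedness of \<open>U\<^sub>3\<close> forces all poles to be
  simple, and then \<open>U\<^sub>0\<close> vanishes exactly at the poles, always to order three
  (\<open>simple_pole_form\<close>, \<open>power_quotient_pole_form\<close>). On a disc, \<open>U\<^sub>0\<close> therefore has a holomorphic
  cube root \<open>h\<close> (\<open>holomorphic_root_exists\<close>), the product \<open>p = f h\<close> is a holomorphic cube root of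
  \<open>U\<^sub>3\<close>, and \<open>f = p / h\<close> with \<open>p\<close> and \<open>h\<close> bounded in terms of \<open>C\<close> alone.

  The normalisation \<open>f'' h\<^sup>3 = 1\<close> becomes the differential equation \<open>W' h - 2 W h' = 1\<close> for the
  Wronskian \<open>W = p' h - p h'\<close>. Every term on its left contains \<open>p\<close> or \<open>h\<close> undifferentiated, and
  Cauchy's estimates bound the derivatives, so \<open>p\<close> and \<open>h\<close> cannot both be small at the centre of
  the disc (\<open>wronskian_lower_bound\<close>). Thus \<open>max \<bar>U\<^sub>0\<bar> \<bar>U\<^sub>3\<bar>\<close> has a positive lower bound which
  depends only on \<open>C\<close> and the distance to the boundary (\<open>power_quotient_lower_bound\<close>).

  Montel's theorem gives a subsequence along which all four quotients converge, to \<open>u\<^sub>j\<close> say, and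
  the lower bound passes to the limit. Where \<open>u\<^sub>0\<close> is bounded away from zero, \<open>f = U\<^sub>1 / U\<^sub>0\<close>
  converges uniformly; where \<open>u\<^sub>3\<close> is, \<open>1 / f = U\<^sub>2 / U\<^sub>3\<close> does (\<open>uniform_limit_sphere_ratio\<close>). The
  spherical limit is \<open>u\<^sub>1 / u\<^sub>0\<close> if \<open>u\<^sub>0\<close> is not identically zero, and \<open>\<infinity>\<close> otherwise.
\<close>

section \<open>Holomorphic roots\<close>

text \<open>
  A holomorphic function whose zeros all have order \<open>n\<close> has a global \<open>n\<close>-th root: dividing out one
  zero at a time leaves a function without zeros, which has a logarithm on a contractible set.
\<close>
lemma holomorphic_root_exists:
  fixes \<phi> :: "complex \<Rightarrow> complex"
  assumes "finite A" "A \<subseteq> S" "open S" "contractible S" "n > 0" "\<phi> holomorphic_on S"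
    and "\<And>z. z \<in> S - A \<Longrightarrow> \<phi> z \<noteq> 0"
    and "\<And>a. a \<in> A \<Longrightarrow> \<exists>k. k analytic_on {a} \<and> k a \<noteq> 0 \<and>
            (\<forall>\<^sub>F z in nhds a. \<phi> z = (z - a) ^ n * k z)"
  obtains h where "h holomorphic_on S" "\<And>z. z \<in> S \<Longrightarrow> h z ^ n = \<phi> z"
proof -
  have "\<exists>h. h holomorphic_on S \<and> (\<forall>z\<in>S. h z ^ n = \<phi> z)"
    using assms
  proof (induction A arbitrary: \<phi> rule: finite_induct)
    case empty
    then obtain g where g: "g holomorphic_on S" "\<And>z. z \<in> S \<Longrightarrow> \<phi> z = exp (g z)"
      using contractible_imp_holomorphic_log[of \<phi> S] by auto
    have "exp (g z / of_nat n) ^ n = \<phi> z" if "z \<in> S" for z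
      using g(2)[OF that] \<open>n > 0\<close> by (simp add: exp_of_nat_mult [symmetric])
    moreover have "(\<lambda>z. exp (g z / of_nat n)) holomorphic_on S"
      using \<open>n > 0\<close> by (intro holomorphic_intros g) auto
    ultimately show ?case by blast
  next
    case (insert a A)
    obtain k where k: "k analytic_on {a}" "k a \<noteq> 0" "\<forall>\<^sub>F z in nhds a. \<phi> z = (z - a) ^ n * k z"
      using insert.prems(7)[of a] by blast
    define \<psi> where "\<psi> = (\<lambda>z. if z = a then k a else \<phi> z / (z - a) ^ n)"
    have "\<forall>\<^sub>F z in nhds a. \<psi> z = k z"
      using k(3) by eventually_elim (auto simp: \<psi>_def)
    then have an_a: "\<psi> analytic_on {a}"
      using k(1) analytic_at_cong[OF _ refl] by blast
    have away: "\<forall>\<^sub>F z in nhds b. \<psi> z = \<phi> z / (z - a) ^ n" if "b \<noteq> a" for b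
      using t1_space_nhds[OF that] by eventually_elim (auto simp: \<psi>_def)
    have an_b: "\<psi> analytic_on {b}" if "b \<in> S" "b \<noteq> a" for b
    proof -
      have "\<phi> analytic_on {b}"
        using insert.prems that holomorphic_on_imp_analytic_at by blast
      then have "(\<lambda>z. \<phi> z / (z - a) ^ n) analytic_on {b}"
        using that by (intro analytic_intros) auto
      then show ?thesis
        using analytic_at_cong[OF away[OF that(2)] refl] by blast
    qed
    have "\<psi> analytic_on S"
      by (subst analytic_on_analytic_at) (use an_a an_b in blast)
    then have hol: "\<psi> holomorphic_on S"
      by (rule analytic_imp_holomorphic)
    have nz: "\<psi> z \<noteq> 0" if "z \<in> S - A" for z
      using that insert.prems k(2) by (auto simp: \<psi>_def)
    have loc: "\<exists>k. k analytic_on {b} \<and> k b \<noteq> 0 \<and> (\<forall>\<^sub>F z in nhds b. \<psi> z = (z - b) ^ n * k z)"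
      if "b \<in> A" for b
    proof -
      have ba: "b \<noteq> a" using that insert.hyps by auto
      obtain l where l: "l analytic_on {b}" "l b \<noteq> 0" "\<forall>\<^sub>F z in nhds b. \<phi> z = (z - b) ^ n * l z"
        using insert.prems(7)[of b] \<open>b \<in> A\<close> by blast
      have "\<forall>\<^sub>F z in nhds b. \<psi> z = (z - b) ^ n * (l z / (z - a) ^ n)"
        using l(3) away[OF ba] by eventually_elim auto
      moreover have "(\<lambda>z. l z / (z - a) ^ n) analytic_on {b}"
        using l ba by (intro analytic_intros) auto
      ultimately show ?thesis
        using l ba by (intro exI[of _ "\<lambda>z. l z / (z - a) ^ n"]) auto
    qed
    obtain h where h: "h holomorphic_on S" "\<forall>z\<in>S. h z ^ n = \<psi> z"
      using insert.IH[of \<psi>] insert.prems hol nz loc by auto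
    have "((z - a) * h z) ^ n = \<phi> z" if "z \<in> S" for z
    proof (cases "z = a")
      case True
      then show ?thesis
        using eventually_nhds_x_imp_x[OF k(3)] \<open>n > 0\<close> by simp
    qed (use h that in \<open>simp add: power_mult_distrib \<psi>_def\<close>)
    moreover have "(\<lambda>z. (z - a) * h z) holomorphic_on S"
      by (intro holomorphic_intros h)
    ultimately show ?case by blast
  qed
  then show ?thesis using that by blast
qed

section \<open>Simple poles and the holomorphic quotients\<close>

lemma deriv_divide_power:
  fixes f g :: "complex \<Rightarrow> complex"
  assumes "open S" "g holomorphic_on S"
    and "\<And>w. w \<in> S - {a} \<Longrightarrow> f w = g w / (w - a) ^ n" and "z \<in> S - {a}"
  shows "deriv f z = (deriv g z * (z - a) - of_nat n * g z) / (z - a) ^ (n + 1)"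
proof -
  have "(g has_field_derivative deriv g z) (at z)"
    using assms holomorphic_derivI by blast
  then have "((\<lambda>w. g w / (w - a) ^ n) has_field_derivative
      (deriv g z * (z - a) ^ n - g z * (of_nat n * (z - a) ^ (n - 1))) / ((z - a) ^ n) ^ 2) (at z)"
    using assms(4) by (auto intro!: derivative_eq_intros simp: power2_eq_square)
  moreover have "(deriv g z * (z - a) ^ n - g z * (of_nat n * (z - a) ^ (n - 1))) / ((z - a) ^ n) ^ 2
      = (deriv g z * (z - a) - of_nat n * g z) / (z - a) ^ (n + 1)"
  proof -
    define t where "t = z - a"
    have "t \<noteq> 0" using assms(4) by (simp add: t_def)
    have "(deriv g z * t ^ n - g z * (of_nat n * t ^ (n - 1))) / (t ^ n)\<^sup>2
      = (deriv g z * t - of_nat n * g z) / t ^ (n + 1)"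
    proof (cases n)
      case (Suc m)
      have "(deriv g z * t ^ n - g z * (of_nat n * t ^ (n - 1))) * t ^ (n + 1)
          = (deriv g z * t - of_nat n * g z) * (t ^ n)\<^sup>2"
        unfolding Suc by (simp add: algebra_simps power2_eq_square)
      then show ?thesis using \<open>t \<noteq> 0\<close> by (intro iffD2[OF frac_eq_eq]) auto
    qed (use \<open>t \<noteq> 0\<close> in simp)
    then show ?thesis unfolding t_def .
  qed
  moreover have "\<forall>\<^sub>F w in nhds z. f w = g w / (w - a) ^ n"
    using eventually_nhds_in_open[OF open_delete[OF assms(1)] assms(4)]
    by (rule eventually_mono) (fact assms(3))
  then have "deriv f z = deriv (\<lambda>w. g w / (w - a) ^ n) z"
    by (rule deriv_cong_ev) simp
  ultimately show ?thesis
    by (metis DERIV_imp_deriv)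
qed

text \<open>
  A nicely meromorphic function has a conventional value at its poles, so the inequality is imposed
  at the other points. Since poles are isolated, it still governs all limits at a pole.
\<close>
locale large_second_derivative =
  fixes f :: "complex \<Rightarrow> complex" and D :: "complex set" and C :: real
  assumes open_D: "open D" and C_pos: "C > 0"
    and mero: "f nicely_meromorphic_on D"
    and large: "\<And>z. z \<in> D \<Longrightarrow> \<not> is_pole f z \<Longrightarrow>
                  C * (1 + cmod (f z) ^ 3) < cmod (deriv (deriv f) z)"
begin

lemma deriv2_nonzero:
  assumes "z \<in> D" "\<not> is_pole f z"
  shows "deriv (deriv f) z \<noteq> 0"
proof
  assume "deriv (deriv f) z = 0"
  then have "C * (1 + cmod (f z) ^ 3) < 0" using large[OF assms] by simp
  moreover have "C * (1 + cmod (f z) ^ 3) \<ge> 0" using C_pos by simp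
  ultimately show False by simp
qed

text \<open>
  At a pole of order \<open>n\<close> the quotient \<open>\<bar>f\<bar>\<^sup>3 / \<bar>f''\<bar>\<close> grows like \<open>\<bar>w - a\<bar>\<close> to the power \<open>2 - 2 n\<close>,
  and it is bounded by \<open>1 / C\<close> at the points near the pole. Hence \<open>n = 1\<close>. The local form then
  makes \<open>f\<close> and \<open>f''\<close> explicit, so that the behaviour of every quotient \<open>f\<^sup>j / f''\<close> can be read off.
\<close>
lemma simple_pole_form:
  assumes "a \<in> D" "is_pole f a"
  obtains r g G where "r > 0" "ball a r \<subseteq> D" "g holomorphic_on ball a r" "G holomorphic_on ball a r"
    "\<And>w. w \<in> ball a r \<Longrightarrow> g w \<noteq> 0" "\<And>w. w \<in> ball a r \<Longrightarrow> G w \<noteq> 0"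
    "\<And>w. w \<in> ball a r - {a} \<Longrightarrow> f w = g w / (w - a)"
    "\<And>w. w \<in> ball a r - {a} \<Longrightarrow> deriv (deriv f) w = G w / (w - a) ^ 3"
    "\<And>w. w \<in> ball a r - {a} \<Longrightarrow> \<not> is_pole f w"
proof -
  have "isolated_singularity_at f a"
    using mero assms(1) meromorphic_on_isolated_singularity meromorphic_on_subset
    unfolding nicely_meromorphic_on_def by blast
  then obtain r1 where r1: "r1 > 0" "f analytic_on ball a r1 - {a}"
    unfolding isolated_singularity_at_def by blast
  obtain r2 where r2: "r2 > 0" "ball a r2 \<subseteq> D"
    using open_D assms(1) openE by blast
  have "f holomorphic_on (ball a (min r1 r2)) - {a}"
    using analytic_imp_holomorphic[OF r1(2)] holomorphic_on_subset by fastforce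
  then obtain r g n where r: "r > 0" "cball a r \<subseteq> ball a (min r1 r2)" "g holomorphic_on cball a r"
    and n: "n > 0" and ga: "g a \<noteq> 0"
    and fg: "\<And>w. w \<in> cball a r - {a} \<Longrightarrow> f w = g w / (w - a) ^ n \<and> g w \<noteq> 0"
    using zorder_exist_pole[of f "ball a (min r1 r2)" a] assms r1 r2
    by (metis centre_in_ball min_less_iff_conj open_ball zero_less_nat_eq neg_0_less_iff_less)
  have nopole: "\<not> is_pole f w" if "w \<in> ball a r - {a}" for w
  proof (rule not_is_pole_holomorphic)
    show "open (ball a r1 - {a})" "f holomorphic_on ball a r1 - {a}" "w \<in> ball a r1 - {a}"
      using analytic_imp_holomorphic[OF r1(2)] that r by (auto simp: subset_eq)
  qed
  have sub: "ball a r \<subseteq> D" using r r2 by (force simp: subset_eq)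
  define g1 where "g1 = (\<lambda>z. deriv g z * (z - a) - of_nat n * g z)"
  define G where "G = (\<lambda>z. deriv g1 z * (z - a) - of_nat (n + 1) * g1 z)"
  have holg: "g holomorphic_on ball a r" using r(3) holomorphic_on_subset by force
  have holg1: "g1 holomorphic_on ball a r"
    unfolding g1_def by (intro holomorphic_intros holg) auto
  have holG: "G holomorphic_on ball a r"
    unfolding G_def by (intro holomorphic_intros holg1) auto
  have d1: "deriv f w = g1 w / (w - a) ^ (n + 1)" if "w \<in> ball a r - {a}" for w
    unfolding g1_def by (rule deriv_divide_power[OF open_ball holg _ that]) (use fg in auto)
  have d2: "deriv (deriv f) w = G w / (w - a) ^ (n + 2)" if "w \<in> ball a r - {a}" for w
    unfolding G_def
    using deriv_divide_power[OF open_ball holg1 _ that, of "deriv f" "n + 1"] d1 by auto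
  have Ga: "G a \<noteq> 0" using ga n by (auto simp: G_def g1_def simp flip: of_nat_Suc)
  have gnz: "g w \<noteq> 0" if "w \<in> ball a r" for w using fg[of w] ga that by (cases "w = a") auto
  have Gnz: "G w \<noteq> 0" if "w \<in> ball a r" for w
    using d2[of w] deriv2_nonzero[of w] nopole[of w] sub that Ga by (cases "w = a") auto
  have ev: "\<forall>\<^sub>F w in at a. w \<in> ball a r - {a}"
    using r(1) by (intro eventually_at_in_open) auto
  have "n = 1"
  proof (rule ccontr)
    assume "n \<noteq> 1"
    with n have n2: "n \<ge> 2" by simp
    \<comment> \<open>multiply the inequality through by \<open>\<bar>w - a\<bar>\<close> to the power \<open>3 n\<close>, then let \<open>w\<close> tend to \<open>a\<close>\<close>
    have "\<forall>\<^sub>F w in at a. C * cmod (g w) ^ 3 \<le> cmod (G w) * cmod (w - a) ^ (2 * n - 2)"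
      using ev
    proof eventually_elim
      case (elim w)
      define t where "t = cmod (w - a)"
      have t: "t > 0" using elim by (simp add: t_def)
      have "C * (cmod (g w) ^ 3 / t ^ (3 * n)) \<le> C * (1 + cmod (f w) ^ 3)"
      proof -
        have "cmod (g w) ^ 3 / t ^ (3 * n) = cmod (f w) ^ 3"
          using fg[of w] elim
          by (simp add: norm_divide norm_power power_divide t_def power_mult [symmetric] mult.commute)
        then show ?thesis using C_pos by simp
      qed
      also have "\<dots> \<le> cmod (G w) / t ^ (n + 2)"
      proof -
        have "w \<in> D" using elim sub by auto
        from large[OF this nopole[OF elim]] show ?thesis
          unfolding d2[OF elim] norm_divide norm_power t_def by (rule less_imp_le)
      qed
      finally have "C * cmod (g w) ^ 3 / t ^ (3 * n) \<le> cmod (G w) / t ^ (n + 2)" by simp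
      then have "C * cmod (g w) ^ 3 / t ^ (3 * n) * t ^ (3 * n) \<le> cmod (G w) / t ^ (n + 2) * t ^ (3 * n)"
        using t by (intro mult_right_mono) auto
      moreover have "3 * n = (n + 2) + (2 * n - 2)"
        using n2 by simp
      then have "t ^ (3 * n) = t ^ (n + 2) * t ^ (2 * n - 2)"
        by (metis power_add)
      ultimately have "C * cmod (g w) ^ 3 \<le> cmod (G w) / t ^ (n + 2) * (t ^ (n + 2) * t ^ (2 * n - 2))"
        using t by (metis less_irrefl nonzero_eq_divide_eq power_not_zero)
      then show ?case using t unfolding t_def [symmetric] by (metis less_irrefl mult.assoc nonzero_eq_divide_eq power_not_zero)
    qed
    moreover have "((\<lambda>w. C * cmod (g w) ^ 3) \<longlongrightarrow> C * cmod (g a) ^ 3) (at a)"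
    proof -
      have "isCont g a"
        using holg r(1) by (meson centre_in_ball continuous_on_eq_continuous_at
            holomorphic_on_imp_continuous_on open_ball)
      then show ?thesis by (intro tendsto_intros) (simp add: isCont_def)
    qed
    moreover have "((\<lambda>w. cmod (G w) * cmod (w - a) ^ (2 * n - 2)) \<longlongrightarrow>
        cmod (G a) * cmod (a - a) ^ (2 * n - 2)) (at a)"
    proof -
      have "isCont G a"
        using holG r(1) by (meson centre_in_ball continuous_on_eq_continuous_at
            holomorphic_on_imp_continuous_on open_ball)
      then show ?thesis by (intro tendsto_intros) (simp add: isCont_def)
    qed
    ultimately have "C * cmod (g a) ^ 3 \<le> cmod (G a) * cmod (a - a) ^ (2 * n - 2)"
      by (intro tendsto_le) auto
    then have "C * cmod (g a) ^ 3 \<le> 0" using n2 by (simp add: power_0_left split: if_splits)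
    moreover have "C * cmod (g a) ^ 3 > 0" using C_pos ga by simp
    ultimately show False by simp
  qed
  show ?thesis
    using that[OF r(1) sub holg holG gnz Gnz] fg d2 nopole \<open>n = 1\<close>
    by (simp add: numeral_3_eq_3)
qed

end

text \<open>
  The removable singularities at the poles of \<open>f\<close> are filled in, so that the quotients carry
  no trace of the conventional values of \<open>f\<close> and its derivatives there.
\<close>
definition power_quotient :: "(complex \<Rightarrow> complex) \<Rightarrow> nat \<Rightarrow> complex \<Rightarrow> complex" where
  "power_quotient f j = remove_sings (\<lambda>w. f w ^ j / deriv (deriv f) w)"

context large_second_derivative
begin

lemma analytic_nonpole: "z \<in> D \<Longrightarrow> \<not> is_pole f z \<Longrightarrow> f analytic_on {z}"
  using mero nicely_meromorphic_on_imp_analytic_at by blast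

lemma quotient_analytic_nonpole:
  assumes "z \<in> D" "\<not> is_pole f z"
  shows "(\<lambda>w. f w ^ j / deriv (deriv f) w) analytic_on {z}"
  using analytic_nonpole[OF assms] deriv2_nonzero[OF assms] by (intro analytic_intros) auto

lemma power_quotient_nonpole:
  assumes "z \<in> D" "\<not> is_pole f z"
  shows "power_quotient f j z = f z ^ j / deriv (deriv f) z"
  using quotient_analytic_nonpole[OF assms] by (simp add: power_quotient_def)

lemma power_quotient_pole_form:
  assumes "a \<in> D" "is_pole f a"
  obtains r g G where "r > 0" "ball a r \<subseteq> D" "g holomorphic_on ball a r" "G holomorphic_on ball a r"
    "\<And>w. w \<in> ball a r \<Longrightarrow> g w \<noteq> 0" "\<And>w. w \<in> ball a r \<Longrightarrow> G w \<noteq> 0"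
    "\<And>w. w \<in> ball a r - {a} \<Longrightarrow> \<not> is_pole f w"
    "\<And>j w. j \<le> 3 \<Longrightarrow> w \<in> ball a r \<Longrightarrow> power_quotient f j w = g w ^ j * (w - a) ^ (3 - j) / G w"
proof -
  obtain r g G where r: "r > 0" "ball a r \<subseteq> D" "g holomorphic_on ball a r" "G holomorphic_on ball a r"
    and nz: "\<And>w. w \<in> ball a r \<Longrightarrow> g w \<noteq> 0" "\<And>w. w \<in> ball a r \<Longrightarrow> G w \<noteq> 0"
    and f: "\<And>w. w \<in> ball a r - {a} \<Longrightarrow> f w = g w / (w - a)"
    "\<And>w. w \<in> ball a r - {a} \<Longrightarrow> deriv (deriv f) w = G w / (w - a) ^ 3"
    and nopole: "\<And>w. w \<in> ball a r - {a} \<Longrightarrow> \<not> is_pole f w"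
    using simple_pole_form[OF assms] by metis
  have "power_quotient f j w = g w ^ j * (w - a) ^ (3 - j) / G w" if j: "j \<le> 3" and w: "w \<in> ball a r" for j w
  proof -
    define U where "U = (\<lambda>w. g w ^ j * (w - a) ^ (3 - j) / G w)"
    have eq: "f w ^ j / deriv (deriv f) w = U w" if "w \<in> ball a r - {a}" for w
    proof -
      define t where "t = w - a"
      have "t \<noteq> 0" using that by (simp add: t_def)
      moreover have "t ^ 3 = t ^ j * t ^ (3 - j)" using j by (simp flip: power_add)
      ultimately show ?thesis
        unfolding f[OF that] U_def t_def [symmetric] using nz(2)[of w] that
        by (simp add: power_divide)
    qed
    show ?thesis
    proof (cases "w = a")
      case True
      have "U holomorphic_on ball a r"
        unfolding U_def by (intro holomorphic_intros r) (use nz in auto)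
      then have "U \<midarrow>a\<rightarrow> U a"
        using r(1) by (meson centre_in_ball continuous_on_eq_continuous_at
            holomorphic_on_imp_continuous_on open_ball isContD)
      moreover have "\<forall>\<^sub>F w in at a. w \<in> ball a r - {a}"
        using r(1) by (intro eventually_at_in_open) auto
      then have "\<forall>\<^sub>F w in at a. U w = f w ^ j / deriv (deriv f) w"
        by eventually_elim (use eq in auto)
      ultimately have "(\<lambda>w. f w ^ j / deriv (deriv f) w) \<midarrow>a\<rightarrow> U a"
        by (rule Lim_transform_eventually)
      then show ?thesis
        unfolding power_quotient_def True U_def by (rule remove_sings_eqI)
    next
      case False
      then show ?thesis using power_quotient_nonpole[of w j] eq[of w] nopole[of w] w r(2) by (auto simp: U_def)
    qed
  qed
  then show ?thesis using that r nz nopole by blast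
qed

lemma power_quotient_holomorphic:
  assumes "j \<le> 3"
  shows "power_quotient f j holomorphic_on D"
proof -
  have "power_quotient f j analytic_on {z}" if "z \<in> D" for z
  proof (cases "is_pole f z")
    case False
    then show ?thesis
      using quotient_analytic_nonpole[OF that False] unfolding power_quotient_def by (intro remove_sings_analytic_on)
  next
    case True
    obtain r g G where *: "r > 0" "g holomorphic_on ball z r" "G holomorphic_on ball z r"
      "\<And>w. w \<in> ball z r \<Longrightarrow> G w \<noteq> 0"
      "\<And>j w. j \<le> 3 \<Longrightarrow> w \<in> ball z r \<Longrightarrow> power_quotient f j w = g w ^ j * (w - z) ^ (3 - j) / G w"
      using power_quotient_pole_form[OF \<open>z \<in> D\<close> True] by metis
    have "(\<lambda>w. g w ^ j * (w - z) ^ (3 - j) / G w) holomorphic_on ball z r"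
      by (intro holomorphic_intros *)
    then have "power_quotient f j holomorphic_on ball z r"
      by (rule holomorphic_transform) (use *(5) assms in auto)
    then show ?thesis using *(1) by (meson analytic_at centre_in_ball open_ball)
  qed
  then show ?thesis
    using analytic_imp_holomorphic analytic_on_analytic_at by blast
qed

lemma power_quotient_eq_0_at_pole:
  assumes "z \<in> D" "is_pole f z" "j < 3"
  shows "power_quotient f j z = 0"
proof -
  obtain r g G where *: "r > 0" 
    "\<And>j w. j \<le> 3 \<Longrightarrow> w \<in> ball z r \<Longrightarrow> power_quotient f j w = g w ^ j * (w - z) ^ (3 - j) / G w"
    using power_quotient_pole_form[OF assms(1,2)] by metis
  show ?thesis using *(1) *(2)[of j z] assms(3) by simp
qed

lemma power_quotient_0_eq_0_iff:
  assumes "z \<in> D"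
  shows "power_quotient f 0 z = 0 \<longleftrightarrow> is_pole f z"
  using power_quotient_eq_0_at_pole[OF assms, of 0] power_quotient_nonpole[OF assms, of 0] deriv2_nonzero[OF assms]
  by (cases "is_pole f z") auto

lemma sphere_val_eq_power_quotient:
  assumes "z \<in> D"
  shows "sphere_val f z = (if power_quotient f 0 z = 0 then Infty else Fin (power_quotient f 1 z / power_quotient f 0 z))"
  using power_quotient_0_eq_0_iff[OF assms] power_quotient_nonpole[OF assms] deriv2_nonzero[OF assms]
  by (auto simp: sphere_val_def)

text \<open>
  These are the algebraic relations between \<open>1\<close>, \<open>f\<close>, \<open>f\<^sup>2\<close> and \<open>f\<^sup>3\<close>. Being polynomial, they survive in
  the limit, where they allow \<open>u\<^sub>1 / u\<^sub>0\<close> to be replaced by \<open>u\<^sub>3 / u\<^sub>2\<close> near a zero of \<open>u\<^sub>0\<close>.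
\<close>
lemma power_quotient_relations:
  assumes "z \<in> D"
  shows "power_quotient f 0 z * power_quotient f 3 z = power_quotient f 1 z * power_quotient f 2 z"
    "power_quotient f 2 z ^ 3 = power_quotient f 0 z * power_quotient f 3 z ^ 2"
proof -
  have "power_quotient f 0 z * power_quotient f 3 z = power_quotient f 1 z * power_quotient f 2 z \<and>
      power_quotient f 2 z ^ 3 = power_quotient f 0 z * power_quotient f 3 z ^ 2"
  proof (cases "is_pole f z")
    case True
    then show ?thesis using power_quotient_eq_0_at_pole[OF assms True] by simp
  next
    case False
    then show ?thesis
      unfolding power_quotient_nonpole[OF assms False]
      by (simp add: power_divide power2_eq_square power3_eq_cube mult.assoc)
  qed
  then show "power_quotient f 0 z * power_quotient f 3 z = power_quotient f 1 z * power_quotient f 2 z"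
    "power_quotient f 2 z ^ 3 = power_quotient f 0 z * power_quotient f 3 z ^ 2"
    by auto
qed

lemma power_quotient_bound:
  assumes "z \<in> D" "j \<le> 3"
  shows "cmod (power_quotient f j z) \<le> 1 / C"
proof -
  have nonpole: "cmod (power_quotient f j w) \<le> 1 / C" if "w \<in> D" "\<not> is_pole f w" for w
  proof -
    have "cmod (f w) ^ j \<le> 1 + cmod (f w) ^ 3"
    proof (cases "cmod (f w) \<le> 1")
      case True
      then have "cmod (f w) ^ j \<le> 1" by (simp add: power_le_one)
      then show ?thesis by (simp add: add_increasing2)
    next
      case False
      then have "cmod (f w) ^ j \<le> cmod (f w) ^ 3" using assms(2) by (intro power_increasing) auto
      then show ?thesis by simp
    qed
    then have "C * cmod (f w) ^ j \<le> cmod (deriv (deriv f) w)"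
      using large[OF that] C_pos by (meson less_imp_le mult_left_mono order_trans)
    then show ?thesis
      unfolding power_quotient_nonpole[OF that] using deriv2_nonzero[OF that] C_pos
      by (simp add: norm_divide norm_power field_simps)
  qed
  show ?thesis
  proof (cases "is_pole f z")
    case True
    obtain r where r: "r > 0" "ball z r \<subseteq> D" "\<And>w. w \<in> ball z r - {z} \<Longrightarrow> \<not> is_pole f w"
      using power_quotient_pole_form[OF assms(1) True] by metis
    have "\<forall>\<^sub>F w in at z. w \<in> ball z r - {z}"
      using r(1) by (intro eventually_at_in_open) auto
    then have "\<forall>\<^sub>F w in at z. cmod (power_quotient f j w) \<le> 1 / C"
      by eventually_elim (use nonpole r in auto)
    moreover have "isCont (power_quotient f j) z"
      using power_quotient_holomorphic[OF assms(2)] open_D assms(1)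
      by (meson continuous_on_eq_continuous_at holomorphic_on_imp_continuous_on)
    then have "((\<lambda>w. cmod (power_quotient f j w)) \<longlongrightarrow> cmod (power_quotient f j z)) (at z)"
      by (intro tendsto_norm) (simp add: isCont_def)
    ultimately show ?thesis
      by (intro tendsto_upperbound[of _ _ "at z"]) auto
  qed (use nonpole assms in blast)
qed

end

section \<open>A lower bound from the Wronskian equation\<close>

text \<open>
  With \<open>W = p' h - p h'\<close> the hypothesis reads \<open>W' h - 2 W h' = 1\<close> at \<open>z\<close>, and it says that the
  second derivative of \<open>p / h\<close> is \<open>1 / h\<^sup>3\<close> wherever \<open>h\<close> is nonzero. Each of the four terms has a
  factor \<open>h z\<close> or \<open>p z\<close>; bounding the remaining factors by \<open>M\<close> and by Cauchy's estimates
  contributes \<open>2 M\<^sup>2 / r\<^sup>2\<close> per term.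
\<close>
lemma wronskian_lower_bound:
  fixes p h :: "complex \<Rightarrow> complex"
  assumes "p holomorphic_on ball z R" "h holomorphic_on ball z R" "0 < r" "r < R"
    and p: "\<And>w. w \<in> ball z R \<Longrightarrow> cmod (p w) < M"
    and h: "\<And>w. w \<in> ball z R \<Longrightarrow> cmod (h w) < M"
    and wronskian: "deriv (deriv p) z * (h z)\<^sup>2 - p z * h z * deriv (deriv h) z
       - 2 * deriv p z * h z * deriv h z + 2 * p z * (deriv h z)\<^sup>2 = 1"
  shows "r\<^sup>2 / (8 * M\<^sup>2) \<le> max (cmod (h z)) (cmod (p z))"
proof -
  define s where "s = max (cmod (h z)) (cmod (p z))"
  have "z \<in> ball z R" using assms by auto
  then have M: "M > 0" using h[of z] norm_ge_zero[of "h z"] by linarith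
  have s: "cmod (h z) \<le> s" "cmod (p z) \<le> s" "s \<ge> 0" and sM: "s \<le> M"
    using p[of z] h[of z] \<open>z \<in> ball z R\<close> by (auto simp: s_def le_max_iff_disj)
  have cauchy: "cmod (deriv u z) \<le> M / r" "cmod (deriv (deriv u) z) \<le> 2 * M / r\<^sup>2"
    if u: "u holomorphic_on ball z R" "\<And>w. w \<in> ball z R \<Longrightarrow> cmod (u w) < M" for u
  proof -
    have sub: "cball z r \<subseteq> ball z R" "ball z r \<subseteq> ball z R" using assms by (auto simp: subset_eq)
    have bound: "cmod ((deriv ^^ n) u z) \<le> fact n * M / r ^ n" if "n > 0" for n
    proof (rule Cauchy_higher_deriv_bound)
      show "u holomorphic_on ball z r" "continuous_on (cball z r) u"
        using u(1) sub holomorphic_on_subset holomorphic_on_imp_continuous_on by blast+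
      show "u w \<in> ball 0 M" if "w \<in> ball z r" for w
        using u(2) sub(2) that by (auto simp: dist_norm)
    qed (use assms that in auto)
    show "cmod (deriv u z) \<le> M / r" "cmod (deriv (deriv u) z) \<le> 2 * M / r\<^sup>2"
      using bound[of 1] bound[of 2] by (simp_all add: numeral_2_eq_2)
  qed
  note dp = cauchy[OF assms(1) p] and dh = cauchy[OF assms(2) h]
  have Mr: "M / r \<ge> 0" "2 * M / r\<^sup>2 \<ge> 0" "2 * M * s / r \<ge> 0" using M assms s by auto
  have t1: "cmod (deriv (deriv p) z * (h z)\<^sup>2) \<le> (2 * M / r\<^sup>2) * (s * M)"
    unfolding norm_mult norm_power power2_eq_square[of "cmod (h z)"]
    using dp dh s sM Mr by (intro mult_mono) auto
  have t2: "cmod (p z * h z * deriv (deriv h) z) \<le> (s * M) * (2 * M / r\<^sup>2)"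
    unfolding norm_mult using dp dh s sM Mr M by (intro mult_mono) auto
  have t3: "cmod (2 * deriv p z * h z * deriv h z) \<le> 2 * (M / r) * s * (M / r)"
    unfolding norm_mult using dp dh s sM Mr M by (intro mult_mono) auto
  have t4: "cmod (2 * p z * (deriv h z)\<^sup>2) \<le> 2 * s * ((M / r) * (M / r))"
    unfolding norm_mult norm_power power2_eq_square[of "cmod (deriv h z)"]
    using dp dh s sM Mr M by (intro mult_mono) auto
  have "1 = cmod (deriv (deriv p) z * (h z)\<^sup>2 - p z * h z * deriv (deriv h) z
       - 2 * deriv p z * h z * deriv h z + 2 * p z * (deriv h z)\<^sup>2)"
    using wronskian by simp
  also have "\<dots> \<le> cmod (deriv (deriv p) z * (h z)\<^sup>2) + cmod (p z * h z * deriv (deriv h) z)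
       + cmod (2 * deriv p z * h z * deriv h z) + cmod (2 * p z * (deriv h z)\<^sup>2)"
    by (intro order_trans[OF norm_triangle_ineq] order_trans[OF norm_triangle_ineq4] add_mono order_refl)
  also have "\<dots> \<le> (2 * M / r\<^sup>2) * (s * M) + (s * M) * (2 * M / r\<^sup>2) + 2 * (M / r) * s * (M / r)
       + 2 * s * ((M / r) * (M / r))"
    using t1 t2 t3 t4 by linarith
  also have "\<dots> = s * (8 * M\<^sup>2) / r\<^sup>2"
    using assms by (simp add: power2_eq_square field_simps)
  finally show ?thesis
    using M assms unfolding s_def [symmetric] by (simp add: field_simps)
qed

text \<open>
  Identities involving \<open>f\<close> are verified away from its poles and carried over to them by continuity.
\<close>
lemma continuous_eq_off_finite:
  fixes u v :: "complex \<Rightarrow> complex"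
  assumes "open S" "finite A" "continuous_on S u" "continuous_on S v"
    and "\<And>w. w \<in> S - A \<Longrightarrow> u w = v w" and "z \<in> S"
  shows "u z = v z"
proof -
  have "open (S - (A - {z}))" using assms by (intro open_Diff finite_imp_closed) auto
  then have "\<forall>\<^sub>F w in at z. w \<in> (S - (A - {z})) - {z}"
    using assms by (intro eventually_at_in_open) auto
  then have "\<forall>\<^sub>F w in at z. u w = v w"
    by eventually_elim (use assms(5) in auto)
  moreover have "(u \<longlongrightarrow> u z) (at z)" "(v \<longlongrightarrow> v z) (at z)"
    using assms continuous_on_eq_continuous_at isCont_def by blast+
  ultimately show ?thesis
    using tendsto_unique[OF _ Lim_transform_eventually[of u "u z" "at z" v]] by auto
qed

context large_second_derivative
begin

text \<open>
  The poles are the zeros of the quotient for \<open>j = 0\<close>, and a single pole in the ball prevents this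
  quotient from being constant, because it is nonzero at the points nearby.
\<close>
lemma finite_poles_in_ball:
  assumes "R < R'" "ball z0 R' \<subseteq> D"
  shows "finite {w \<in> ball z0 R. is_pole f w}"
proof (cases "\<exists>a\<in>ball z0 R. is_pole f a")
  case True
  then obtain a where a: "a \<in> ball z0 R" "is_pole f a" by blast
  have sub: "ball z0 R \<subseteq> ball z0 R'" "cball z0 R \<subseteq> ball z0 R'" using assms by (auto simp: subset_eq)
  then have aD: "a \<in> D" "a \<in> ball z0 R'" using a assms by auto
  obtain r where r: "r > 0" "ball a r \<subseteq> D" "\<And>w. w \<in> ball a r - {a} \<Longrightarrow> \<not> is_pole f w"
    using power_quotient_pole_form[OF aD(1) a(2)] by metis
  have "\<forall>\<^sub>F w in at a. w \<in> ball a r \<inter> ball z0 R' - {a}"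
    using r(1) aD by (intro eventually_at_in_open) auto
  then obtain b where b: "b \<in> ball a r" "b \<in> ball z0 R'" "b \<noteq> a"
    using eventually_happens[of _ "at a"] by auto
  have "power_quotient f 0 b \<noteq> 0" "power_quotient f 0 a = 0"
    using power_quotient_0_eq_0_iff aD a b r by auto
  then have "\<not> power_quotient f 0 constant_on ball z0 R'"
    using aD b unfolding constant_on_def by metis
  then have "finite {w \<in> cball z0 R. power_quotient f 0 w = 0}"
    using assms sub power_quotient_holomorphic[of 0]
    by (intro holomorphic_compact_finite_zeros[of _ "ball z0 R'"]) (auto intro: holomorphic_on_subset)
  then show ?thesis
    by (rule finite_subset[rotated]) (use power_quotient_0_eq_0_iff assms sub in force)
next
  case False
  then have "{w \<in> ball z0 R. is_pole f w} = {}" by blast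
  then show ?thesis by (metis finite.emptyI)
qed

text \<open>
  Here \<open>h\<close> and \<open>p\<close> are the cube roots of the quotients for \<open>j = 0\<close> and \<open>j = 3\<close>. Three concentric
  discs are used: finiteness of the pole set in the middle one comes from the largest one, and the
  middle one leaves room for Cauchy's estimates on the smallest.
\<close>
lemma power_quotient_lower_bound:
  assumes "r > 0" "ball z0 (3 * r) \<subseteq> D"
  shows "(r\<^sup>2 / (8 * (1 + 1 / C)\<^sup>2)) ^ 3 \<le> max (cmod (power_quotient f 0 z0)) (cmod (power_quotient f 3 z0))"
proof -
  define S where "S = ball z0 (2 * r)"
  define A where "A = {w \<in> S. is_pole f w}"
  define M where "M = 1 + 1 / C"
  have S: "open S" "contractible S" "S \<subseteq> D" "z0 \<in> S"
    using assms by (auto simp: S_def convex_imp_contractible subset_eq)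
  have finA: "finite A"
    unfolding A_def S_def using assms by (intro finite_poles_in_ball[of _ "3 * r"]) auto
  have AS: "A \<subseteq> S" by (auto simp: A_def)
  have SA: "w \<in> D" "\<not> is_pole f w" if "w \<in> S - A" for w
    using that S by (auto simp: A_def)
  have openSA: "open (S - A)" using S finA by (intro open_Diff finite_imp_closed) auto
  \<comment> \<open>\<open>M\<close> is a convenient upper bound for the cube root of \<open>1 / C\<close>\<close>
  have cube_small: "x < M" if "x ^ 3 \<le> 1 / C" for x
  proof -
    have M1: "M \<ge> 1" using C_pos by (simp add: M_def)
    have "x ^ 3 < M" using that by (simp add: M_def)
    also have "M \<le> M ^ 3" using power_increasing[of 1 3 M] M1 by simp
    finally show ?thesis using M1 by (intro power_less_imp_less_base[of x 3 M]) auto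
  qed
  have holq: "power_quotient f j holomorphic_on S" if "j \<le> 3" for j
    using power_quotient_holomorphic[OF that] S holomorphic_on_subset by blast
  obtain h where h: "h holomorphic_on S" "\<And>z. z \<in> S \<Longrightarrow> h z ^ 3 = power_quotient f 0 z"
  proof (rule holomorphic_root_exists[OF finA AS S(1,2), of 3 "power_quotient f 0"])
    show "power_quotient f 0 z \<noteq> 0" if "z \<in> S - A" for z
      using SA[OF that] power_quotient_0_eq_0_iff by blast
    show "\<exists>k. k analytic_on {a} \<and> k a \<noteq> 0 \<and> (\<forall>\<^sub>F z in nhds a. power_quotient f 0 z = (z - a) ^ 3 * k z)"
      if a: "a \<in> A" for a
    proof -
      have "a \<in> D" "is_pole f a" using a S by (auto simp: A_def)
      then obtain \<rho> g G where *: "\<rho> > 0" "G holomorphic_on ball a \<rho>"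
        "\<And>w. w \<in> ball a \<rho> \<Longrightarrow> G w \<noteq> 0"
        "\<And>j w. j \<le> 3 \<Longrightarrow> w \<in> ball a \<rho> \<Longrightarrow> power_quotient f j w = g w ^ j * (w - a) ^ (3 - j) / G w"
        using power_quotient_pole_form by metis
      have "(\<lambda>w. 1 / G w) holomorphic_on ball a \<rho>" by (intro holomorphic_intros *)
      then have "(\<lambda>w. 1 / G w) analytic_on {a}" using *(1) by (meson analytic_at centre_in_ball open_ball)
      moreover have "\<forall>\<^sub>F w in nhds a. w \<in> ball a \<rho>"
        using *(1) by (intro eventually_nhds_in_open) auto
      then have "\<forall>\<^sub>F w in nhds a. power_quotient f 0 w = (w - a) ^ 3 * (1 / G w)"
        by eventually_elim (use *(4)[of 0] in simp)
      ultimately show ?thesis using *(1,3) by (intro exI[of _ "\<lambda>w. 1 / G w"]) auto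
    qed
  qed (use holq in auto)
  have fhol: "f holomorphic_on S - A"
  proof (rule analytic_imp_holomorphic, subst analytic_on_analytic_at)
    show "\<forall>w\<in>S - A. f analytic_on {w}" using analytic_nonpole SA by blast
  qed
  have hSA: "h holomorphic_on S - A" using h(1) holomorphic_on_subset by blast
  have fh3: "(f w * h w) ^ 3 = power_quotient f 3 w" if "w \<in> S - A" for w
    using h(2)[of w] SA[OF that] power_quotient_nonpole[of w] that by (simp add: power_mult_distrib)
  have fh_small: "cmod (f w * h w) < M" if "w \<in> S - A" for w
  proof -
    have "cmod (f w * h w) ^ 3 = cmod (power_quotient f 3 w)"
      unfolding fh3[OF that, symmetric] by (simp only: norm_power)
    then show ?thesis using cube_small power_quotient_bound[of w 3] SA[OF that] by simp
  qed
  \<comment> \<open>the bounded function \<open>f h\<close> extends over the poles of \<open>f\<close>\<close>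
  have "\<exists>p. p holomorphic_on S \<and> (\<forall>z\<in>S - A. p z = f z * h z)"
  proof (rule removable_singularities[OF finA])
    show "A \<subseteq> interior S" using AS S(1) by (simp add: interior_open)
    show "(\<lambda>z. f z * h z) holomorphic_on S - A" by (intro holomorphic_intros fhol hSA)
    show "(\<lambda>z. f z * h z) \<in> O[at a](\<lambda>_. 1)" if "a \<in> A" for a
    proof (rule bigoI)
      have "open (S - (A - {a}))" using S finA by (intro open_Diff finite_imp_closed) auto
      then have "\<forall>\<^sub>F w in at a. w \<in> (S - (A - {a})) - {a}"
        using AS that by (intro eventually_at_in_open) auto
      then show "\<forall>\<^sub>F w in at a. cmod (f w * h w) \<le> M * norm (1::complex)"
        by eventually_elim (use fh_small in \<open>force intro: less_imp_le\<close>)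
    qed
  qed
  then obtain p where p: "p holomorphic_on S" "\<And>z. z \<in> S - A \<Longrightarrow> p z = f z * h z" by blast
  have p3: "p z ^ 3 = power_quotient f 3 z" if "z \<in> S" for z
    by (rule continuous_eq_off_finite[OF S(1) finA _ _ _ that])
      (use p fh3 holq[of 3] in \<open>auto intro!: holomorphic_intros holomorphic_on_imp_continuous_on\<close>)
  have cube_bound: "cmod (u w) < M" if "w \<in> S" "u w ^ 3 = power_quotient f j w" "j \<le> 3" for u w j
    using cube_small[of "cmod (u w)"] power_quotient_bound[of w j] that S by (metis norm_power subsetD)
  have dp: "deriv p w = deriv f w * h w + f w * deriv h w" if "w \<in> S - A" for w
  proof (rule DERIV_imp_deriv, rule has_field_derivative_transform_within_open[OF _ openSA that])
    show "((\<lambda>z. f z * h z) has_field_derivative deriv f w * h w + f w * deriv h w) (at w)"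
      using holomorphic_derivI[OF fhol openSA that] holomorphic_derivI[OF hSA openSA that]
      by (auto intro!: derivative_eq_intros)
  qed (use p in auto)
  have ddp: "deriv (deriv p) w = deriv (deriv f) w * h w + 2 * deriv f w * deriv h w + f w * deriv (deriv h) w"
    if "w \<in> S - A" for w
  proof (rule DERIV_imp_deriv, rule has_field_derivative_transform_within_open[OF _ openSA that])
    note d = holomorphic_derivI[OF fhol openSA that] holomorphic_derivI[OF hSA openSA that]
      holomorphic_derivI[OF holomorphic_deriv[OF fhol openSA] openSA that]
      holomorphic_derivI[OF holomorphic_deriv[OF hSA openSA] openSA that]
    show "((\<lambda>z. deriv f z * h z + f z * deriv h z) has_field_derivative
        deriv (deriv f) w * h w + 2 * deriv f w * deriv h w + f w * deriv (deriv h) w) (at w)"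
      using d by (auto intro!: derivative_eq_intros)
  qed (use dp in auto)
  \<comment> \<open>substituting \<open>p = f h\<close>, all terms but \<open>f'' h\<^sup>3\<close> cancel off the poles\<close>
  define T where "T = (\<lambda>z. deriv (deriv p) z * (h z)\<^sup>2 - p z * h z * deriv (deriv h) z
       - 2 * deriv p z * h z * deriv h z + 2 * p z * (deriv h z)\<^sup>2)"
  have "T z0 = 1"
  proof (rule continuous_eq_off_finite[OF S(1) finA _ _ _ S(4)])
    have "T holomorphic_on S"
      unfolding T_def by (intro holomorphic_intros p h S)
    then show "continuous_on S T" by (rule holomorphic_on_imp_continuous_on)
    show "T w = 1" if "w \<in> S - A" for w
    proof -
      have "T w = deriv (deriv f) w * h w ^ 3"
        unfolding T_def dp[OF that] ddp[OF that] p(2)[OF that]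
        by (simp add: algebra_simps power2_eq_square power3_eq_cube)
      also have "\<dots> = 1"
        using h(2)[of w] that power_quotient_nonpole[OF SA[OF that], of 0] deriv2_nonzero[OF SA[OF that]] by simp
      finally show ?thesis .
    qed
  qed auto
  moreover have "cmod (p w) < M" "cmod (h w) < M" if "w \<in> S" for w
    using cube_bound[of w p 3] cube_bound[of w h 0] p3 h(2) that by auto
  ultimately have "r\<^sup>2 / (8 * M\<^sup>2) \<le> max (cmod (h z0)) (cmod (p z0))"
    using p(1) h(1) assms(1) unfolding T_def S_def
    by (intro wronskian_lower_bound[of p z0 "2 * r" h r M]) auto
  then have "(r\<^sup>2 / (8 * M\<^sup>2)) ^ 3 \<le> max (cmod (h z0)) (cmod (p z0)) ^ 3"
    by (intro power_mono) auto
  also have "\<dots> = max (cmod (power_quotient f 0 z0)) (cmod (power_quotient f 3 z0))"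
    unfolding h(2)[OF S(4), symmetric] p3[OF S(4), symmetric] norm_power
    by (auto simp: max_def power_mono_iff)
  finally show ?thesis unfolding M_def .
qed

end

section \<open>Simultaneous convergence of finitely many sequences\<close>

lemma Montel_finitely_many:
  fixes F :: "nat \<Rightarrow> nat \<Rightarrow> complex \<Rightarrow> complex"
  assumes "open S"
    and "\<And>j n. j < m \<Longrightarrow> F j n holomorphic_on S"
    and "\<And>j n z. j < m \<Longrightarrow> z \<in> S \<Longrightarrow> cmod (F j n z) \<le> B"
  obtains r u where "strict_mono (r :: nat \<Rightarrow> nat)" "\<And>j. j < m \<Longrightarrow> u j holomorphic_on S"
    "\<And>j K. j < m \<Longrightarrow> compact K \<Longrightarrow> K \<subseteq> S \<Longrightarrow> uniform_limit K (\<lambda>n. F j (r n)) (u j) sequentially"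
proof -
  have "\<exists>r u. strict_mono (r :: nat \<Rightarrow> nat) \<and> (\<forall>j<m. u j holomorphic_on S \<and>
      (\<forall>K. compact K \<and> K \<subseteq> S \<longrightarrow> uniform_limit K (\<lambda>n. F j (r n)) (u j) sequentially))"
    using assms(2,3)
  proof (induction m)
    case 0
    have "strict_mono (\<lambda>n::nat. n)" by (simp add: strict_mono_def)
    then show ?case by blast
  next
    case (Suc m)
    then obtain r u where r: "strict_mono (r :: nat \<Rightarrow> nat)"
      and u: "\<And>j. j < m \<Longrightarrow> u j holomorphic_on S"
        "\<And>j K. j < m \<Longrightarrow> compact K \<Longrightarrow> K \<subseteq> S \<Longrightarrow> uniform_limit K (\<lambda>n. F j (r n)) (u j) sequentially"
      by (metis less_SucI)
    obtain g t where g: "g holomorphic_on S" and t: "strict_mono (t :: nat \<Rightarrow> nat)"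
      and lim: "\<And>K. compact K \<Longrightarrow> K \<subseteq> S \<Longrightarrow> uniform_limit K ((\<lambda>n. F m (r n)) \<circ> t) g sequentially"
    proof (rule Montel[of S "range (\<lambda>n. F m (r n))" "\<lambda>n. F m (r n)"])
      show "\<exists>B. \<forall>h\<in>range (\<lambda>n. F m (r n)). \<forall>z\<in>K. cmod (h z) \<le> B" if "K \<subseteq> S" for K
        using Suc.prems(2)[of m] that by blast
    qed (use assms(1) Suc.prems(1)[of m] in auto)
    have old: "uniform_limit K (\<lambda>n. F j (r (t n))) (u j) sequentially"
      if "j < m" "compact K" "K \<subseteq> S" for j K
      using filterlim_compose[OF u(2)[OF that] filterlim_subseq[OF t]] by simp
    have "strict_mono (r \<circ> t)" using r t by (rule strict_mono_o)
    moreover have "(u(m := g)) j holomorphic_on S" if "j < Suc m" for j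
      using u g that by (auto simp: less_Suc_eq)
    moreover have "uniform_limit K (\<lambda>n. F j ((r \<circ> t) n)) ((u(m := g)) j) sequentially"
      if "j < Suc m" "compact K" "K \<subseteq> S" for j K
      using old[of j K] lim[of K] that by (auto simp: less_Suc_eq o_def)
    ultimately show ?case by blast
  qed
  then show ?thesis using that by blast
qed

section \<open>Spherical convergence in two charts\<close>

text \<open>The inversion \<open>v \<mapsto> 1 / v\<close>, which is the chart of the sphere around \<open>\<infinity>\<close>.\<close>
definition inversion :: "complex \<Rightarrow> sphere" where
  "inversion v = (if v = 0 then Infty else Fin (1 / v))"

lemma sqrt_one_plus_inverse_square:
  "v \<noteq> 0 \<Longrightarrow> sqrt (1 + (1 / cmod v)\<^sup>2) = sqrt (1 + (cmod v)\<^sup>2) / cmod v"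
proof -
  assume v: "v \<noteq> 0"
  then have "1 + (1 / cmod v)\<^sup>2 = (1 + (cmod v)\<^sup>2) / (cmod v)\<^sup>2"
    by (simp add: power_divide field_simps)
  then show ?thesis by (simp add: real_sqrt_divide)
qed

text \<open>
  Inversion is a rotation of the sphere. Hence convergence near \<open>\<infinity>\<close> may be tested on reciprocals.
\<close>
lemma spherical_dist_inversion:
  "spherical_dist (inversion v) (inversion w) = spherical_dist (Fin v) (Fin w)"
proof -
  have pos: "sqrt (1 + (cmod z)\<^sup>2) > 0" for z
    using zero_le_power2[of "cmod z"] by (intro real_sqrt_gt_zero) linarith
  have eq: "1 / v - 1 / w = (w - v) / (v * w)" if "v \<noteq> 0" "w \<noteq> 0"
    using that by (simp add: field_simps)
  show ?thesis
    using pos[of v] pos[of w]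
    by (cases "v = 0"; cases "w = 0")
      (simp_all add: inversion_def sqrt_one_plus_inverse_square eq norm_divide norm_mult
        norm_minus_commute del: real_sqrt_gt_0_iff)
qed

text \<open>
  The argument of the arcsine is at most \<open>\<bar>v - w\<bar>\<close>, because both square roots are at least \<open>1\<close>, and
  at most \<open>1\<close>, by the Cauchy-Schwarz inequality for \<open>(\<bar>v\<bar>, 1)\<close> and \<open>(1, \<bar>w\<bar>)\<close>.
\<close>
lemma spherical_dist_Fin_nonneg: "0 \<le> spherical_dist (Fin v) (Fin w)"
  and spherical_dist_Fin_small:
    "0 < t \<Longrightarrow> t \<le> pi / 2 \<Longrightarrow> cmod (v - w) < sin t \<Longrightarrow> spherical_dist (Fin v) (Fin w) \<le> 2 * t"
proof -
  define x where "x = cmod (v - w) / (sqrt (1 + (cmod v)\<^sup>2) * sqrt (1 + (cmod w)\<^sup>2))"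
  have ge1: "1 \<le> sqrt (1 + (cmod v)\<^sup>2) * sqrt (1 + (cmod w)\<^sup>2)"
    using mult_mono[of 1 "sqrt (1 + (cmod v)\<^sup>2)" 1 "sqrt (1 + (cmod w)\<^sup>2)"] by simp
  have x0: "0 \<le> x" by (simp add: x_def)
  have "cmod (v - w) \<le> cmod v * 1 + 1 * cmod w" using norm_triangle_ineq4 by simp
  also have "\<dots> \<le> sqrt (1 + (cmod v)\<^sup>2) * sqrt (1 + (cmod w)\<^sup>2)"
  proof -
    have "(cmod v * 1 + 1 * cmod w)\<^sup>2 \<le> (1 + (cmod v)\<^sup>2) * (1 + (cmod w)\<^sup>2)"
      using zero_le_power2[of "cmod v * cmod w - 1"] by (simp add: power2_eq_square algebra_simps)
    then show ?thesis by (simp flip: real_sqrt_mult add: real_le_rsqrt)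
  qed
  finally have x1: "x \<le> 1" using ge1 by (simp add: x_def divide_le_eq)
  show "0 \<le> spherical_dist (Fin v) (Fin w)"
    using arcsin_nonneg[of x] x0 x1 by (simp add: x_def)
  assume t: "0 < t" "t \<le> pi / 2" "cmod (v - w) < sin t"
  have "x \<le> cmod (v - w) / 1"
    unfolding x_def using ge1 by (intro divide_left_mono) auto
  then have "arcsin x \<le> arcsin (sin t)"
    using t x0 by (intro arcsin_le_arcsin) auto
  also have "arcsin (sin t) = t" using t by (intro arcsin_sin) auto
  finally show "spherical_dist (Fin v) (Fin w) \<le> 2 * t" by (simp add: x_def)
qed

lemma uniform_limit_imp_spherical:
  assumes "uniform_limit X s l F"
  shows "uniform_limit X (\<lambda>n z. spherical_dist (Fin (s n z)) (Fin (l z))) (\<lambda>z. 0) F"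
proof (rule uniform_limitI)
  fix e :: real assume "e > 0"
  define t where "t = min (e / 3) (pi / 2)"
  have t: "0 < t" "t \<le> pi / 2" "2 * t < e" using \<open>e > 0\<close> by (auto simp: t_def)
  then have "sin t > 0" by (intro sin_gt_zero) (auto simp: t_def min_def)
  from uniform_limitD[OF assms this]
  show "\<forall>\<^sub>F n in F. \<forall>z\<in>X. dist (spherical_dist (Fin (s n z)) (Fin (l z))) 0 < e"
  proof eventually_elim
    case (elim n)
    show ?case
    proof
      fix z assume "z \<in> X"
      then have "cmod (s n z - l z) < sin t" using elim by (simp add: dist_norm)
      then have "spherical_dist (Fin (s n z)) (Fin (l z)) \<le> 2 * t"
        using spherical_dist_Fin_small t by blast
      then show "dist (spherical_dist (Fin (s n z)) (Fin (l z))) 0 < e"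
        using spherical_dist_Fin_nonneg[of "s n z" "l z"] t
        by (simp add: dist_real_def del: spherical_dist.simps)
    qed
  qed
qed

text \<open>
  The point of the sphere with homogeneous coordinates \<open>a : b\<close>, for \<open>a\<close> and \<open>b\<close> not both zero.
\<close>
definition sphere_ratio :: "complex \<Rightarrow> complex \<Rightarrow> sphere" where
  "sphere_ratio a b = (if b = 0 then Infty else Fin (a / b))"

lemma sphere_ratio_inversion:
  assumes "a0 * a3 = a1 * a2" "a2 ^ 3 = a0 * a3\<^sup>2" "a3 \<noteq> 0"
  shows "sphere_ratio a1 a0 = inversion (a2 / a3)"
proof (cases "a0 = 0")
  case True
  then show ?thesis using assms(2) by (simp add: sphere_ratio_def inversion_def)
next
  case False
  then have "a2 \<noteq> 0" using assms by auto
  then show ?thesis using assms False by (simp add: sphere_ratio_def inversion_def field_simps)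
qed

lemma uniform_limit_eventually_norm_ge:
  fixes s :: "nat \<Rightarrow> 'a \<Rightarrow> 'b::real_normed_vector"
  assumes "uniform_limit X s l F" "\<delta> > 0" "\<And>z. z \<in> X \<Longrightarrow> \<delta> \<le> norm (l z)"
  shows "\<forall>\<^sub>F n in F. \<forall>z\<in>X. s n z \<noteq> 0"
  using uniform_limitD[OF assms(1,2)]
proof eventually_elim
  case (elim n)
  show ?case
  proof (intro ballI notI)
    fix z assume "z \<in> X" "s n z = 0"
    then show False using elim assms(3)[of z] by (force simp: dist_norm)
  qed
qed

text \<open>
  The set \<open>K\<close> is the union of a part on which \<open>u\<^sub>0\<close> is bounded away from zero and a part on which \<open>u\<^sub>3\<close>
  is. On the first part the quotients \<open>U\<^sub>1 / U\<^sub>0\<close> converge uniformly in the plane; on the second the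
  quotients \<open>U\<^sub>2 / U\<^sub>3\<close> do, and they represent the same points of the sphere in the inverted chart.
\<close>
lemma uniform_limit_sphere_ratio:
  fixes U :: "nat \<Rightarrow> nat \<Rightarrow> complex \<Rightarrow> complex" and u :: "nat \<Rightarrow> complex \<Rightarrow> complex"
  assumes lim: "\<And>j. j \<le> 3 \<Longrightarrow> uniform_limit K (U j) (u j) sequentially"
    and bdd: "\<And>j. j \<le> 3 \<Longrightarrow> bounded (u j ` K)"
    and rel: "\<And>n z. z \<in> K \<Longrightarrow> U 0 n z * U 3 n z = U 1 n z * U 2 n z"
      "\<And>n z. z \<in> K \<Longrightarrow> U 2 n z ^ 3 = U 0 n z * (U 3 n z)\<^sup>2"
    and rel_lim: "\<And>z. z \<in> K \<Longrightarrow> u 0 z * u 3 z = u 1 z * u 2 z"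
      "\<And>z. z \<in> K \<Longrightarrow> u 2 z ^ 3 = u 0 z * (u 3 z)\<^sup>2"
    and "\<delta> > 0" and low: "\<And>z. z \<in> K \<Longrightarrow> \<delta> \<le> max (cmod (u 0 z)) (cmod (u 3 z))"
  shows "uniform_limit K (\<lambda>n z. spherical_dist (sphere_ratio (U 1 n z) (U 0 n z)) (sphere_ratio (u 1 z) (u 0 z)))
           (\<lambda>z. 0) sequentially"
proof -
  define K0 where "K0 = {z \<in> K. \<delta> \<le> cmod (u 0 z)}"
  define K3 where "K3 = {z \<in> K. \<delta> \<le> cmod (u 3 z)}"
  have sub: "K0 \<subseteq> K" "K3 \<subseteq> K" and K: "K = K0 \<union> K3"
    using low by (auto simp: K0_def K3_def le_max_iff_disj)
  have lim0: "uniform_limit K0 (U j) (u j) sequentially" and lim3: "uniform_limit K3 (U j) (u j) sequentially"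
    and b0: "bounded (u j ` K0)" and b3: "bounded (u j ` K3)" if "j \<le> 3" for j
    using lim[OF that] bdd[OF that] sub by (auto intro: uniform_limit_on_subset bounded_subset)
  have low0: "\<And>z. z \<in> K0 \<Longrightarrow> \<delta> \<le> norm (u 0 z)" and low3: "\<And>z. z \<in> K3 \<Longrightarrow> \<delta> \<le> norm (u 3 z)"
    by (auto simp: K0_def K3_def)
  have "uniform_limit K0 (\<lambda>n z. spherical_dist (sphere_ratio (U 1 n z) (U 0 n z)) (sphere_ratio (u 1 z) (u 0 z)))
      (\<lambda>z. 0) sequentially"
  proof -
    have "uniform_limit K0 (\<lambda>n z. U 1 n z / U 0 n z) (\<lambda>z. u 1 z / u 0 z) sequentially"
      using lim0[of 1] lim0[of 0] b0[of 1] low0 \<open>\<delta> > 0\<close> by (intro uniform_lim_divide) auto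
    note uniform_limit_imp_spherical[OF this]
    moreover have "\<forall>\<^sub>F n in sequentially. \<forall>z\<in>K0.
        spherical_dist (Fin (U 1 n z / U 0 n z)) (Fin (u 1 z / u 0 z)) =
        spherical_dist (sphere_ratio (U 1 n z) (U 0 n z)) (sphere_ratio (u 1 z) (u 0 z))"
      using uniform_limit_eventually_norm_ge[OF lim0[of 0] \<open>\<delta> > 0\<close> low0]
      by (rule eventually_mono) (use low0 \<open>\<delta> > 0\<close> in \<open>force simp: sphere_ratio_def\<close>)+
    ultimately show ?thesis
      by (rule iffD1[OF uniform_limit_cong[OF _ refl], rotated])
  qed
  moreover have "uniform_limit K3 (\<lambda>n z. spherical_dist (sphere_ratio (U 1 n z) (U 0 n z)) (sphere_ratio (u 1 z) (u 0 z)))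
      (\<lambda>z. 0) sequentially"
  proof -
    have "uniform_limit K3 (\<lambda>n z. U 2 n z / U 3 n z) (\<lambda>z. u 2 z / u 3 z) sequentially"
      using lim3[of 2] lim3[of 3] b3[of 2] low3 \<open>\<delta> > 0\<close> by (intro uniform_lim_divide) auto
    note uniform_limit_imp_spherical[OF this]
    moreover have "\<forall>\<^sub>F n in sequentially. \<forall>z\<in>K3.
        spherical_dist (Fin (U 2 n z / U 3 n z)) (Fin (u 2 z / u 3 z)) =
        spherical_dist (sphere_ratio (U 1 n z) (U 0 n z)) (sphere_ratio (u 1 z) (u 0 z))"
      using uniform_limit_eventually_norm_ge[OF lim3[OF order_refl] \<open>\<delta> > 0\<close> low3, simplified]
    proof eventually_elim
      case (elim n)
      show ?case
      proof
        fix z assume z: "z \<in> K3"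
        then have "u 3 z \<noteq> 0" "U 3 n z \<noteq> 0" "z \<in> K" using low3[OF z] \<open>\<delta> > 0\<close> elim sub by auto
        then have "sphere_ratio (U 1 n z) (U 0 n z) = inversion (U 2 n z / U 3 n z)"
          "sphere_ratio (u 1 z) (u 0 z) = inversion (u 2 z / u 3 z)"
          using sphere_ratio_inversion rel rel_lim by blast+
        then show "spherical_dist (Fin (U 2 n z / U 3 n z)) (Fin (u 2 z / u 3 z)) =
          spherical_dist (sphere_ratio (U 1 n z) (U 0 n z)) (sphere_ratio (u 1 z) (u 0 z))"
          by (simp only: spherical_dist_inversion)
      qed
    qed
    ultimately show ?thesis
      by (rule iffD1[OF uniform_limit_cong[OF _ refl], rotated])
  qed
  ultimately show ?thesis unfolding K by (rule uniform_limit_on_Un)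
qed

section \<open>The limit function and normality\<close>

text \<open>
  At a zero of \<open>u\<^sub>0\<close> the quotient \<open>u\<^sub>1 / u\<^sub>0\<close> has a pole even though \<open>u\<^sub>1\<close> vanishes there too: nearby it
  equals \<open>u\<^sub>3 / u\<^sub>2\<close>, with \<open>u\<^sub>3\<close> nonzero and \<open>u\<^sub>2\<close> zero at the point. The convention \<open>x / 0 = 0\<close>
  provides precisely the value \<open>0\<close> that a nicely meromorphic function takes at its poles.
\<close>
lemma quotient_nicely_meromorphic:
  fixes u0 u1 u2 u3 :: "complex \<Rightarrow> complex"
  assumes "open D" "connected D" "\<beta> \<in> D" "u0 \<beta> \<noteq> 0"
    and hol: "u0 holomorphic_on D" "u1 holomorphic_on D" "u2 holomorphic_on D" "u3 holomorphic_on D"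
    and rel: "\<And>z. z \<in> D \<Longrightarrow> u0 z * u3 z = u1 z * u2 z" "\<And>z. z \<in> D \<Longrightarrow> u2 z ^ 3 = u0 z * (u3 z)\<^sup>2"
    and common: "\<And>z. z \<in> D \<Longrightarrow> u0 z = 0 \<Longrightarrow> u3 z \<noteq> 0"
  shows "(\<lambda>z. u1 z / u0 z) nicely_meromorphic_on D"
    and "\<And>z. z \<in> D \<Longrightarrow> sphere_val (\<lambda>z. u1 z / u0 z) z = sphere_ratio (u1 z) (u0 z)"
proof -
  define g where "g = (\<lambda>z. u1 z / u0 z)"
  have cont: "isCont u0 z" "isCont u1 z" "isCont u2 z" "isCont u3 z" if "z \<in> D" for z
    using hol \<open>open D\<close> that by (meson continuous_on_eq_continuous_at holomorphic_on_imp_continuous_on)+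
  have regular: "g \<midarrow>z\<rightarrow> g z" if "z \<in> D" "u0 z \<noteq> 0" for z
  proof -
    have "isCont g z" unfolding g_def using cont[OF that(1)] that by (intro continuous_intros) auto
    then show ?thesis by (simp add: isCont_def)
  qed
  have pole: "is_pole g z" if z: "z \<in> D" "u0 z = 0" for z
  proof -
    obtain r where r: "0 < r" "ball z r \<subseteq> D" "\<And>w. w \<in> ball z r - {z} \<Longrightarrow> u0 w \<noteq> 0"
      using isolated_zeros[OF hol(1) assms(1,2) z assms(3,4)] by metis
    have u3: "u3 z \<noteq> 0" using common z by blast
    have "u2 z ^ 3 = 0" using rel(2)[OF z(1)] z(2) by simp
    then have u2: "u2 z = 0" by simp
    have "\<forall>\<^sub>F w in at z. w \<in> ball z r - {z}"
      using r(1) by (intro eventually_at_in_open) auto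
    moreover have "\<forall>\<^sub>F w in at z. u3 w \<noteq> 0"
      using cont(4)[OF z(1)] u3 by (intro tendsto_imp_eventually_ne) (simp add: isCont_def)
    ultimately have ev: "\<forall>\<^sub>F w in at z. u2 w \<noteq> 0 \<and> g w = u3 w / u2 w"
    proof eventually_elim
      case (elim w)
      then have w: "w \<in> D" "u0 w \<noteq> 0" using r by auto
      then have "u2 w ^ 3 \<noteq> 0" using rel(2)[of w] elim by simp
      then have "u2 w \<noteq> 0" by auto
      then show ?case using rel(1)[of w] w by (simp add: g_def field_simps)
    qed
    have "filterlim u2 (at 0) (at z)"
      using cont(3)[OF z(1)] u2 ev by (intro filterlim_atI) (auto simp: isCont_def elim: eventually_mono)
    then have "is_pole (\<lambda>w. u3 w / u2 w) z"
      using cont(4)[OF z(1)] u3 by (intro is_pole_divide) auto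
    moreover have "\<forall>\<^sub>F w in at z. g w = u3 w / u2 w"
      using ev by eventually_elim simp
    ultimately show ?thesis
      using is_pole_cong[of g "\<lambda>w. u3 w / u2 w" z z] by simp
  qed
  have "u0 analytic_on D" "u1 analytic_on D" using hol \<open>open D\<close> by (simp_all add: analytic_on_open)
  then have mero: "g meromorphic_on D"
    unfolding g_def by (intro meromorphic_intros analytic_on_imp_meromorphic_on)
  have g0: "g z = 0" if "u0 z = 0" for z using that by (simp add: g_def)
  have "g nicely_meromorphic_on D"
    unfolding nicely_meromorphic_on_def using mero regular pole g0 by blast
  then show "(\<lambda>z. u1 z / u0 z) nicely_meromorphic_on D" by (simp only: g_def)
  have "sphere_val g z = sphere_ratio (u1 z) (u0 z)" if "z \<in> D" for z
  proof (cases "u0 z = 0")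
    case False
    then have "\<not> is_pole g z"
      using regular[OF that False] unfolding is_pole_def
      by (meson not_tendsto_and_filterlim_at_infinity trivial_limit_at)
    then show ?thesis using False by (simp add: sphere_val_def sphere_ratio_def g_def)
  qed (use pole[OF that] in \<open>simp add: sphere_val_def sphere_ratio_def\<close>)
  then show "\<And>z. z \<in> D \<Longrightarrow> sphere_val (\<lambda>z. u1 z / u0 z) z = sphere_ratio (u1 z) (u0 z)"
    by (simp only: g_def)
qed

theorem theorem1:
  fixes D :: "complex set" and C :: real
  assumes "is_domain D" and "C > 0"
  shows "normal_family D
           {f. f nicely_meromorphic_on D \<and> (\<forall>z\<in>D. deriv2_quotient f z > C)}"
  unfolding normal_family_def
proof (intro allI impI)
  fix s :: "nat \<Rightarrow> complex \<Rightarrow> complex"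
  assume s: "\<forall>n. s n \<in> {f. f nicely_meromorphic_on D \<and> (\<forall>z\<in>D. deriv2_quotient f z > C)}"
  have D: "open D" "connected D" using assms by (auto simp: is_domain_def)
  have admissible: "large_second_derivative (s n) D C" for n
  proof
    show "s n nicely_meromorphic_on D" using s by auto
    show "C * (1 + cmod (s n z) ^ 3) < cmod (deriv (deriv (s n)) z)"
      if "z \<in> D" "\<not> is_pole (s n) z" for z
    proof -
      have "C < cmod (deriv (deriv (s n)) z) / (1 + cmod (s n z) ^ 3)"
      proof -
        have "C < deriv2_quotient (s n) z" using s that(1) by blast
        then show ?thesis unfolding deriv2_quotient_def using that(2) by simp
      qed
      moreover have "0 < 1 + cmod (s n z) ^ 3" by (simp add: add_pos_nonneg)
      ultimately show ?thesis by (simp add: less_divide_eq)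
    qed
  qed (use D assms in auto)
  obtain r u where r: "strict_mono (r :: nat \<Rightarrow> nat)"
    and hol: "\<And>j. j < 4 \<Longrightarrow> u j holomorphic_on D"
    and lim: "\<And>j K. j < 4 \<Longrightarrow> compact K \<Longrightarrow> K \<subseteq> D \<Longrightarrow>
           uniform_limit K (\<lambda>n. power_quotient (s (r n)) j) (u j) sequentially"
    using Montel_finitely_many[of D 4 "\<lambda>j n. power_quotient (s n) j" "1 / C"] D
      large_second_derivative.power_quotient_holomorphic[OF admissible]
      large_second_derivative.power_quotient_bound[OF admissible] by (auto simp: less_eq_Suc_le)
  have pointwise: "(\<lambda>n. power_quotient (s (r n)) j z) \<longlonglongrightarrow> u j z" if "j < 4" "z \<in> D" for j z
    using tendsto_uniform_limitI[OF lim[of j "{z}"], of z] that by simp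
  have rel: "u 0 z * u 3 z = u 1 z * u 2 z" "u 2 z ^ 3 = u 0 z * (u 3 z)\<^sup>2" if z: "z \<in> D" for z
  proof -
    note p = pointwise[OF _ z]
    have "(\<lambda>n. power_quotient (s (r n)) 0 z * power_quotient (s (r n)) 3 z) \<longlonglongrightarrow> u 0 z * u 3 z"
      "(\<lambda>n. power_quotient (s (r n)) 1 z * power_quotient (s (r n)) 2 z) \<longlonglongrightarrow> u 1 z * u 2 z"
      "(\<lambda>n. power_quotient (s (r n)) 2 z ^ 3) \<longlonglongrightarrow> u 2 z ^ 3"
      "(\<lambda>n. power_quotient (s (r n)) 0 z * (power_quotient (s (r n)) 3 z)\<^sup>2) \<longlonglongrightarrow> u 0 z * (u 3 z)\<^sup>2"
      by (intro tendsto_intros p; simp)+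
    then show "u 0 z * u 3 z = u 1 z * u 2 z" "u 2 z ^ 3 = u 0 z * (u 3 z)\<^sup>2"
      unfolding large_second_derivative.power_quotient_relations[OF admissible z]
      using LIMSEQ_unique by blast+
  qed
  \<comment> \<open>the lower bound is uniform in the sequence and hence passes to the limit\<close>
  define \<delta> where "\<delta> = (\<lambda>\<rho>. (\<rho>\<^sup>2 / (8 * (1 + 1 / C)\<^sup>2)) ^ 3)"
  have low: "\<delta> \<rho> \<le> max (cmod (u 0 z)) (cmod (u 3 z))" if "\<rho> > 0" "ball z (3 * \<rho>) \<subseteq> D" for z \<rho>
  proof -
    have z: "z \<in> D" using that by auto
    have "(\<lambda>n. max (cmod (power_quotient (s (r n)) 0 z)) (cmod (power_quotient (s (r n)) 3 z)))
        \<longlonglongrightarrow> max (cmod (u 0 z)) (cmod (u 3 z))"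
      by (intro tendsto_intros pointwise z) auto
    then show ?thesis
      unfolding \<delta>_def
      using large_second_derivative.power_quotient_lower_bound[OF admissible that]
      by (intro tendsto_lowerbound) (auto intro: always_eventually)
  qed
  have \<delta>_pos: "\<delta> \<rho> > 0" if "\<rho> > 0" for \<rho>
  proof -
    have "1 + 1 / C > 0" using assms by (simp add: add_pos_pos)
    then show ?thesis using that by (simp add: \<delta>_def)
  qed
  have conv: "uniform_limit K (\<lambda>n z. spherical_dist (sphere_val (s (r n)) z) (sphere_ratio (u 1 z) (u 0 z)))
      (\<lambda>z. 0) sequentially" if K: "compact K" "K \<subseteq> D" for K
  proof -
    obtain \<epsilon> where \<epsilon>: "\<epsilon> > 0" "(\<Union>z\<in>K. cball z \<epsilon>) \<subseteq> D"
      using compact_subset_open_imp_cball_epsilon_subset[OF K(1) D(1) K(2)] by blast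
    have "uniform_limit K (\<lambda>n z. spherical_dist
        (sphere_ratio (power_quotient (s (r n)) 1 z) (power_quotient (s (r n)) 0 z)) (sphere_ratio (u 1 z) (u 0 z))) (\<lambda>z. 0) sequentially"
    proof (rule uniform_limit_sphere_ratio[where U = "\<lambda>j n. power_quotient (s (r n)) j"])
      show "uniform_limit K (\<lambda>n. power_quotient (s (r n)) j) (u j) sequentially" if "j \<le> 3" for j
        using lim K that by simp
      show "bounded (u j ` K)" if "j \<le> 3" for j
        using hol[of j] K that
        by (intro compact_imp_bounded compact_continuous_image)
          (auto intro: holomorphic_on_imp_continuous_on holomorphic_on_subset)
      show "\<delta> (\<epsilon> / 3) > 0" using \<epsilon> \<delta>_pos by simp
      show "\<delta> (\<epsilon> / 3) \<le> max (cmod (u 0 z)) (cmod (u 3 z))" if "z \<in> K" for z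
      proof -
        have "ball z \<epsilon> \<subseteq> D" using \<epsilon> that ball_subset_cball[of z \<epsilon>] by blast
        then show ?thesis using low[of "\<epsilon> / 3" z] \<epsilon> by simp
      qed
    qed (use rel K large_second_derivative.power_quotient_relations[OF admissible] in auto)
    then show ?thesis
      using K large_second_derivative.sphere_val_eq_power_quotient[OF admissible]
      by (subst uniform_limit_cong') (auto simp: sphere_ratio_def)
  qed
  have common: "u 3 z \<noteq> 0" if "z \<in> D" "u 0 z = 0" for z
  proof -
    obtain \<epsilon> where \<epsilon>: "\<epsilon> > 0" "ball z \<epsilon> \<subseteq> D" by (rule openE[OF D(1) \<open>z \<in> D\<close>])
    then show ?thesis using low[of "\<epsilon> / 3" z] \<delta>_pos[of "\<epsilon> / 3"] that by auto
  qed
  show "\<exists>r :: nat \<Rightarrow> nat. strict_mono r \<and>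
          ((\<exists>g. g nicely_meromorphic_on D \<and>
              spherically_locally_uniform_limit D (\<lambda>n. sphere_val (s (r n))) (sphere_val g)) \<or>
           spherically_locally_uniform_limit D (\<lambda>n. sphere_val (s (r n))) (\<lambda>z. Infty))"
  proof (cases "\<exists>\<beta>\<in>D. u 0 \<beta> \<noteq> 0")
    case True
    then obtain \<beta> where \<beta>: "\<beta> \<in> D" "u 0 \<beta> \<noteq> 0" by blast
    define g where "g = (\<lambda>z. u 1 z / u 0 z)"
    have g: "g nicely_meromorphic_on D" "\<And>z. z \<in> D \<Longrightarrow> sphere_val g z = sphere_ratio (u 1 z) (u 0 z)"
      unfolding g_def
      by (intro quotient_nicely_meromorphic[of D \<beta> "u 0" "u 1" "u 2" "u 3"] D \<beta> hol rel common; simp)+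
    have "spherically_locally_uniform_limit D (\<lambda>n. sphere_val (s (r n))) (sphere_val g)"
      unfolding spherically_locally_uniform_limit_def
    proof (intro allI impI)
      fix K assume K: "compact K \<and> K \<subseteq> D"
      then show "uniform_limit K (\<lambda>n z. spherical_dist (sphere_val (s (r n)) z) (sphere_val g z))
          (\<lambda>z. 0) sequentially"
        using conv[of K] g(2) by (subst uniform_limit_cong') auto
    qed
    then show ?thesis using r g(1) by blast
  next
    case False
    have "spherically_locally_uniform_limit D (\<lambda>n. sphere_val (s (r n))) (\<lambda>z. Infty)"
      unfolding spherically_locally_uniform_limit_def
    proof (intro allI impI)
      fix K assume K: "compact K \<and> K \<subseteq> D"
      then show "uniform_limit K (\<lambda>n z. spherical_dist (sphere_val (s (r n)) z) Infty) (\<lambda>z. 0) sequentially"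
        using conv[of K] False by (subst uniform_limit_cong') (auto simp: sphere_ratio_def)
    qed
    then show ?thesis using r by blast
  qed
qed

end
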